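(* Let $X$ and $Y$ be uniformly locally finite metric spaces. The following are equivalent: (1) There is a bijective coarse quotient map $f:X\to Y$. (2) There is an embedding $\Phi:\mathrm{C}^*_u(X)\to \mathrm{C}^*_u(Y)$ such that $\Phi(\ell_\infty(X))=\ell_\infty(Y)$ and $\Phi(\mathrm{C}^*_u(X))$ is cobounded in $\mathrm{C}^*_u(Y)$. (3) There are $\varepsilon\in(0,1)$ and an embedding $\Phi:\mathrm{C}^*_u(X)\to \mathrm{C}^*_u(Y)$ such that $\Phi(\ell_\infty(X))=\ell_\infty(Y)$ and $\Phi(\mathrm{C}^*_u(X))$ is $\varepsilon$-almost cobounded in $\mathrm{C}^*_u(Y)$.
   Context: A metric space $(X,d)$ is uniformly locally finite (u.l.f.) if for every $r>0$, $\sup_{x\in X}|B(x,r)|<\infty$, where $B(x,r)$ is the closed ball. For $A\subset X$ and $K>0$, $A^K=\{x\in X: d(x,A)\le K\}$. A map $f:(X,d)\to(Y,\partial)$ is coarse if $\omega_f(t)=\sup\{\partial(f(x),f(y)): d(x,y)\le t\}<\infty$ for all $t\ge0$. Given $K>0$, $f$ is $K$-co-coarse if for every $\varepsilon>0$ there is $\delta>0$ with $B(f(x),\varepsilon)\subset f(B(x,\delta))^K$ for all $x\in X$; $f$ is co-coarse if it is $K$-co-coarse for some $K>0$, and a coarse quotient (map) if it is both coarse and co-coarse. For a set $X$, $(\delta_x)_{x\in X}$ is the standard basis of $\ell_2(X)$; $\ell_\infty(X)$ is identified with the diagonal operators on $\ell_2(X)$. For $a\in\mathcal B(\ell_2(X))$,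 $\mathrm{propg}(a)=\sup\{d(x,y): \langle a\delta_x,\delta_y\rangle\neq0\}$. The uniform Roe algebra $\mathrm{C}^*_u(X)$ is the norm closure of the $*$-algebra of operators on $\ell_2(X)$ of finite propagation. An embedding is an injective $*$-homomorphism. Let $A\subset\mathrm{C}^*_u(X)$ be a $\mathrm{C}^*$-subalgebra. For $\varepsilon,k,\ell>0$, $b\in\mathrm{C}^*_u(X)$ is $(\varepsilon,k,\ell)$-cobounded if there are $a_1,\dots,a_\ell\in A$ with $\|a_i\|\le\ell$ and $c_1,\dots,c_\ell\in\mathrm{C}^*_u(X)$ with $\mathrm{propg}(c_i)\le k$, $\|c_i\|\le\ell$, such that $\|b-\sum_{i=1}^\ell c_ia_i\|\le\varepsilon$; $b$ is $(\varepsilon,k)$-cobounded if it is $(\varepsilon,k,\ell)$-cobounded for some $\ell$. $A$ is cobounded in $\mathrm{C}^*_u(X)$ if there is $k>0$ such that every $b\in\mathrm{C}^*_u(X)$ is $(\varepsilon,k)$-cobounded for all $\varepsilon>0$. For $\mathrm{C}^*$-subalgebras $A_1\subset A_2\subset\mathrm{C}^*_u(X)$ and $\varepsilon>0$, $A_1$ is $\varepsilon$-almost cobounded in $A_2$ if there is $k>0$ such that for all $b\in A_2$ there are $a_1,\dots,a_\ell\in A_1$ and $c_1,\dots,c_\ell\in A_2$ with $\mathrm{propg}(c_i)\le k$ and $\|b-\sum_{i=1}^\ell c_ia_i\|\le\varepsilon$. *)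

theory Defs
  imports "HOL-Analysis.Analysis" "HOL-Library.Function_Algebras"
begin

definition ulf :: "'a::metric_space itself \<Rightarrow> bool" where
  "ulf _ \<longleftrightarrow> (\<forall>r>0. \<exists>N::nat. \<forall>x::'a. finite (cball x r) \<and> card (cball x r) \<le> N)"

definition coarse_map :: "('a::metric_space \<Rightarrow> 'b::metric_space) \<Rightarrow> bool" where
  "coarse_map f \<longleftrightarrow> (\<forall>t\<ge>0. \<exists>M. \<forall>x y. dist x y \<le> t \<longrightarrow> dist (f x) (f y) \<le> M)"

definition nbhd :: "'a::metric_space set \<Rightarrow> real \<Rightarrow> 'a set" where
  "nbhd A K = {z. infdist z A \<le> K}"

definition K_cocoarse :: "real \<Rightarrow> ('a::metric_space \<Rightarrow> 'b::metric_space) \<Rightarrow> bool" where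
  "K_cocoarse K f \<longleftrightarrow> (\<forall>\<epsilon>>0. \<exists>\<delta>>0. \<forall>x. cball (f x) \<epsilon> \<subseteq> nbhd (f ` cball x \<delta>) K)"

definition cocoarse :: "('a::metric_space \<Rightarrow> 'b::metric_space) \<Rightarrow> bool" where
  "cocoarse f \<longleftrightarrow> (\<exists>K>0. K_cocoarse K f)"

definition coarse_quotient :: "('a::metric_space \<Rightarrow> 'b::metric_space) \<Rightarrow> bool" where
  "coarse_quotient f \<longleftrightarrow> coarse_map f \<and> cocoarse f"

text \<open>An operator a on l2(X) is represented by its matrix w.r.t. the standard basis:
  m y x = <a delta_x, delta_y>.  Pointwise +, -, 0 come from Function_Algebras.\<close>

type_synonym 'a mat = "'a \<Rightarrow> 'a \<Rightarrow> complex"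

definition supp_v :: "('a \<Rightarrow> complex) \<Rightarrow> 'a set" where
  "supp_v f = {x. f x \<noteq> 0}"

definition l2norm :: "('a \<Rightarrow> complex) \<Rightarrow> real" where
  "l2norm f = sqrt (\<Sum>\<^sub>\<infinity>x. (cmod (f x))\<^sup>2)"

text \<open>Sesquilinear form <m f, g> for finitely supported f, g.\<close>
definition bform :: "'a mat \<Rightarrow> ('a \<Rightarrow> complex) \<Rightarrow> ('a \<Rightarrow> complex) \<Rightarrow> complex" where
  "bform m g f = (\<Sum>y\<in>supp_v g. \<Sum>x\<in>supp_v f. cnj (g y) * m y x * f x)"

definition bounded_mat :: "'a mat \<Rightarrow> bool" where
  "bounded_mat m \<longleftrightarrow> (\<exists>C. \<forall>f g. finite (supp_v f) \<longrightarrow> finite (supp_v g) \<longrightarrow>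
      cmod (bform m g f) \<le> C * l2norm f * l2norm g)"

text \<open>Operator norm (correct for bounded matrices).\<close>
definition opnorm :: "'a mat \<Rightarrow> real" where
  "opnorm m = Sup {cmod (bform m g f) | f g. finite (supp_v f) \<and> finite (supp_v g)
      \<and> l2norm f \<le> 1 \<and> l2norm g \<le> 1}"

definition mmult :: "'a mat \<Rightarrow> 'a mat \<Rightarrow> 'a mat" where
  "mmult a b = (\<lambda>y x. \<Sum>\<^sub>\<infinity>z. a y z * b z x)"

definition madj :: "'a mat \<Rightarrow> 'a mat" where
  "madj a = (\<lambda>y x. cnj (a x y))"

definition mscale :: "complex \<Rightarrow> 'a mat \<Rightarrow> 'a mat" where
  "mscale c a = (\<lambda>y x. c * a y x)"

definition propg_le :: "'a::metric_space mat \<Rightarrow> real \<Rightarrow> bool" where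
  "propg_le m k \<longleftrightarrow> (\<forall>x y. m y x \<noteq> 0 \<longrightarrow> dist x y \<le> k)"

definition finite_propg :: "'a::metric_space mat \<Rightarrow> bool" where
  "finite_propg m \<longleftrightarrow> (\<exists>k. propg_le m k)"

definition roe :: "'a::metric_space mat set" where
  "roe = {m. bounded_mat m \<and> (\<forall>\<epsilon>>0. \<exists>b. bounded_mat b \<and> finite_propg b \<and> opnorm (m - b) \<le> \<epsilon>)}"

text \<open>l_infty(X) as diagonal operators.\<close>
definition diag_ops :: "'a mat set" where
  "diag_ops = {m. bounded_mat m \<and> (\<forall>x y. x \<noteq> y \<longrightarrow> m y x = 0)}"

definition roe_embedding :: "('a::metric_space mat \<Rightarrow> 'b::metric_space mat) \<Rightarrow> bool" where
  "roe_embedding \<Phi> \<longleftrightarrow> \<Phi> ` roe \<subseteq> roe \<and> inj_on \<Phi> roe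
     \<and> (\<forall>a\<in>roe. \<forall>b\<in>roe. \<Phi> (a + b) = \<Phi> a + \<Phi> b)
     \<and> (\<forall>a\<in>roe. \<forall>c. \<Phi> (mscale c a) = mscale c (\<Phi> a))
     \<and> (\<forall>a\<in>roe. \<forall>b\<in>roe. \<Phi> (mmult a b) = mmult (\<Phi> a) (\<Phi> b))
     \<and> (\<forall>a\<in>roe. \<Phi> (madj a) = madj (\<Phi> a))"

definition cobounded_elt :: "'a::metric_space mat set \<Rightarrow> real \<Rightarrow> real \<Rightarrow> nat \<Rightarrow> 'a mat \<Rightarrow> bool" where
  "cobounded_elt A \<epsilon> k l b \<longleftrightarrow> (\<exists>a c :: nat \<Rightarrow> 'a mat.
      (\<forall>i<l. a i \<in> A \<and> opnorm (a i) \<le> real l \<and> c i \<in> roe \<and> propg_le (c i) k \<and> opnorm (c i) \<le> real l)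
      \<and> opnorm (b - (\<Sum>i<l. mmult (c i) (a i))) \<le> \<epsilon>)"

definition cobounded :: "'a::metric_space mat set \<Rightarrow> bool" where
  "cobounded A \<longleftrightarrow> (\<exists>k>0. \<forall>b\<in>roe. \<forall>\<epsilon>>0. \<exists>l>0. cobounded_elt A \<epsilon> k l b)"

definition almost_cobounded :: "real \<Rightarrow> 'a::metric_space mat set \<Rightarrow> 'a mat set \<Rightarrow> bool" where
  "almost_cobounded \<epsilon> A1 A2 \<longleftrightarrow> (\<exists>k>0. \<forall>b\<in>A2. \<exists>l. \<exists>a c :: nat \<Rightarrow> 'a mat.
      (\<forall>i<l. a i \<in> A1 \<and> c i \<in> A2 \<and> propg_le (c i) k)
      \<and> opnorm (b - (\<Sum>i<l. mmult (c i) (a i))) \<le> \<epsilon>)"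

end

theory Submission
  imports Defs
begin

text \<open>A bijective coarse quotient \<open>f\<close> acts on matrices by relabelling indices; coarseness keeps the
  relabelled matrices in the Roe algebra, and co-coarseness factors every band matrix on \<open>Y\<close> as a
  finite sum of products of band matrices of uniformly bounded width with images of band matrices
  on \<open>X\<close>.

  Conversely, an embedding that maps diagonal operators onto diagonal operators permutes the minimal
  diagonal projections, which yields a bijection \<open>f\<close>; since it then maps matrix units to matrix units
  up to unimodular scalars, it preserves the moduli of all matrix entries up to relabelling by \<open>f\<close>.
  Applying this to the indicator matrix of \<open>{(x, y). dist x y \<le> t}\<close> gives coarseness of \<open>f\<close>.
  Approximating the indicator matrix of \<open>{(x, y). dist x y \<le> r}\<close> on \<open>Y\<close> by \<open>\<Sum>c\<^sub>i a\<^sub>i\<close> with error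
  less than 1 gives co-coarseness: where \<open>f\<close> fails to be co-coarse, all entries of the \<open>a\<^sub>i\<close> that
  enter the sum are too small.\<close>

section \<open>Sesquilinear forms, norm bounds and matrix entries\<close>

text \<open>Turning the constant of \<open>bounded_mat\<close> into an argument lets explicit bounds
  be carried through differences, products and relabellings. For bounded \<open>m\<close>,
  \<open>opnorm m\<close> is the least nonnegative such constant, by
  \<open>form_bound_opnorm\<close> and \<open>opnorm_le\<close>.\<close>

definition form_bound :: "'a mat \<Rightarrow> real \<Rightarrow> bool" where
  "form_bound m C \<longleftrightarrow> (\<forall>f g. finite (supp_v f) \<longrightarrow> finite (supp_v g) \<longrightarrow>
      cmod (bform m g f) \<le> C * l2norm f * l2norm g)"

lemma bounded_mat_iff_form_bound: "bounded_mat m \<longleftrightarrow> (\<exists>C. form_bound m C)"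
  unfolding bounded_mat_def form_bound_def ..

lemma l2norm_eq_L2_set:
  assumes "finite S" "supp_v f \<subseteq> S"
  shows "l2norm f = L2_set (\<lambda>x. cmod (f x)) S"
proof -
  have "(\<Sum>\<^sub>\<infinity>x. (cmod (f x))\<^sup>2) = (\<Sum>\<^sub>\<infinity>x\<in>S. (cmod (f x))\<^sup>2)"
    by (rule infsum_cong_neutral) (use assms in \<open>auto simp: supp_v_def\<close>)
  then show ?thesis
    using assms by (simp add: l2norm_def L2_set_def)
qed

lemma l2norm_nonneg [simp]: "0 \<le> l2norm f"
  unfolding l2norm_def by (simp add: infsum_nonneg)

lemma bform_eq_sum:
  assumes "finite S" "supp_v f \<subseteq> S" "finite T" "supp_v g \<subseteq> T"
  shows "bform m g f = (\<Sum>y\<in>T. \<Sum>x\<in>S. cnj (g y) * m y x * f x)"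
proof -
  have "bform m g f = (\<Sum>y\<in>supp_v g. \<Sum>x\<in>S. cnj (g y) * m y x * f x)"
    unfolding bform_def
    by (intro sum.cong refl sum.mono_neutral_left) (use assms in \<open>auto simp: supp_v_def\<close>)
  also have "\<dots> = (\<Sum>y\<in>T. \<Sum>x\<in>S. cnj (g y) * m y x * f x)"
    by (intro sum.mono_neutral_left) (use assms in \<open>auto simp: supp_v_def\<close>)
  finally show ?thesis .
qed

lemma supp_v_scale: "supp_v (\<lambda>x. c * f x) \<subseteq> supp_v f"
  by (auto simp: supp_v_def)

lemma l2norm_scale: "finite (supp_v f) \<Longrightarrow> l2norm (\<lambda>x. c * f x) = cmod c * l2norm f"
  using l2norm_eq_L2_set[of "supp_v f" f] l2norm_eq_L2_set[of "supp_v f" "\<lambda>x. c * f x"]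
    supp_v_scale[of c f]
  by (simp add: norm_mult L2_set_right_distrib)

lemma bform_scale:
  assumes "finite (supp_v f)" "finite (supp_v g)"
  shows "bform m (\<lambda>y. d * g y) (\<lambda>x. c * f x) = cnj d * c * bform m g f"
  unfolding bform_eq_sum[OF assms(1) supp_v_scale assms(2) supp_v_scale]
    bform_eq_sum[OF assms(1) order_refl assms(2) order_refl]
  by (simp add: sum_distrib_left mult_ac)

lemma l2norm_eq_0D:
  assumes "finite (supp_v f)" "l2norm f = 0"
  shows "f x = 0"
  using assms l2norm_eq_L2_set[of "supp_v f" f] by (auto simp: L2_set_eq_0_iff supp_v_def)

lemma bform_zero [simp]: "bform m (\<lambda>_. 0) f = 0" "bform m g (\<lambda>_. 0) = 0"
  by (simp_all add: bform_def)

lemma l2norm_zero [simp]: "l2norm (\<lambda>_. 0) = 0"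
  by (simp add: l2norm_def)

lemma supp_v_zero [simp]: "supp_v (\<lambda>_. 0) = {}"
  by (simp add: supp_v_def)

text \<open>Boundedness makes the set under \<open>Sup\<close> bounded above, so
  \<open>opnorm\<close> dominates the form on vectors of norm at most 1. Normalising both vectors
  extends this to all pairs; a vector of norm 0 is zero and has to be treated apart.\<close>

lemma form_bound_opnorm:
  assumes "bounded_mat m"
  shows "form_bound m (opnorm m)"
  unfolding form_bound_def
proof (intro allI impI)
  fix f g :: "'a \<Rightarrow> complex"
  assume fin: "finite (supp_v f)" "finite (supp_v g)"
  obtain C where C: "form_bound m C" using assms bounded_mat_iff_form_bound by blast
  let ?A = "{cmod (bform m g f) | f g. finite (supp_v f) \<and> finite (supp_v g)
      \<and> l2norm f \<le> 1 \<and> l2norm g \<le> 1}"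
  have bdd: "bdd_above ?A"
  \<comment> \<open>The sign of \<open>C\<close> is not known at this point, hence the absolute
    value.\<close>
  proof (rule bdd_aboveI[of _ "\<bar>C\<bar>"], clarify)
    fix f g :: "'a \<Rightarrow> complex"
    assume *: "finite (supp_v f)" "finite (supp_v g)" "l2norm f \<le> 1" "l2norm g \<le> 1"
    have "cmod (bform m g f) \<le> C * l2norm f * l2norm g"
      using C * by (simp add: form_bound_def)
    also have "\<dots> \<le> \<bar>C\<bar> * 1 * 1"
      using * by (intro mult_mono) (simp_all add: abs_ge_self)
    finally show "cmod (bform m g f) \<le> \<bar>C\<bar>" by simp
  qed
  show "cmod (bform m g f) \<le> opnorm m * l2norm f * l2norm g"
  proof (cases "l2norm f = 0 \<or> l2norm g = 0")
    case True
    then have "f = (\<lambda>_. 0) \<or> g = (\<lambda>_. 0)"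
      using l2norm_eq_0D[OF fin(1)] l2norm_eq_0D[OF fin(2)] by auto
    then show ?thesis by auto
  next
    case False
    then have pos: "0 < l2norm f" "0 < l2norm g"
      using l2norm_nonneg[of f] l2norm_nonneg[of g] by linarith+
    define f1 where "f1 = (\<lambda>x. of_real (1 / l2norm f) * f x)"
    define g1 where "g1 = (\<lambda>x. of_real (1 / l2norm g) * g x)"
    have "finite (supp_v f1)" "finite (supp_v g1)"
      unfolding f1_def g1_def by (rule finite_subset[OF supp_v_scale], rule fin)+
    moreover have "l2norm f1 \<le> 1" "l2norm g1 \<le> 1"
      unfolding f1_def g1_def using fin pos by (simp_all add: l2norm_scale del: of_real_divide)
    ultimately have "cmod (bform m g1 f1) \<in> ?A" by blast
    then have "cmod (bform m g1 f1) \<le> opnorm m"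
      unfolding opnorm_def using bdd by (rule cSup_upper)
    moreover have "cmod (bform m g1 f1) = cmod (bform m g f) / (l2norm f * l2norm g)"
      unfolding f1_def g1_def bform_scale[OF fin] using pos
      by (simp add: norm_mult norm_divide)
    ultimately show ?thesis using pos by (simp add: field_simps)
  qed
qed

lemma opnorm_le:
  assumes "form_bound m C" "0 \<le> C"
  shows "opnorm m \<le> C"
  unfolding opnorm_def
proof (rule cSup_least)
  show "{cmod (bform m g f) | f g. finite (supp_v f) \<and> finite (supp_v g)
      \<and> l2norm f \<le> 1 \<and> l2norm g \<le> 1} \<noteq> {}"
    using l2norm_zero supp_v_zero by (metis (mono_tags, lifting) empty_iff finite.emptyI
        mem_Collect_eq zero_le_one)
next
  fix r
  assume "r \<in> {cmod (bform m g f) | f g. finite (supp_v f) \<and> finite (supp_v g)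
      \<and> l2norm f \<le> 1 \<and> l2norm g \<le> 1}"
  then obtain f g where r: "r = cmod (bform m g f)" and *: "finite (supp_v f)" "finite (supp_v g)"
      "l2norm f \<le> 1" "l2norm g \<le> 1"
    by blast
  have "r \<le> C * l2norm f * l2norm g" using assms(1) * r by (simp add: form_bound_def)
  also have "\<dots> \<le> C * 1 * 1" using * assms(2) by (intro mult_mono) auto
  finally show "r \<le> C" by simp
qed

text \<open>Entries are values of the form at unit basis vectors. This is how norm estimates become
  the entrywise estimates from which the geometry is read off.\<close>

lemma form_bound_entry:
  assumes "form_bound m C"
  shows "cmod (m y x) \<le> C"
proof -
  define d :: "'a \<Rightarrow> 'a \<Rightarrow> complex" where "d = (\<lambda>x z. if z = x then 1 else 0)"
  have s: "supp_v (d x) = {x}" for x by (auto simp: supp_v_def d_def)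
  have n: "l2norm (d x) = 1" for x
    using l2norm_eq_L2_set[of "{x}" "d x"] by (simp add: s, simp add: L2_set_def d_def)
  have "bform m (d y) (d x) = m y x" by (simp add: bform_def s, simp add: d_def)
  moreover have "cmod (bform m (d y) (d x)) \<le> C * l2norm (d x) * l2norm (d y)"
    using assms by (simp add: form_bound_def s)
  ultimately show ?thesis by (simp add: n)
qed

lemma entry_le_opnorm: "bounded_mat m \<Longrightarrow> cmod (m y x) \<le> opnorm m"
  by (rule form_bound_entry[OF form_bound_opnorm])

lemma opnorm_nonneg: "bounded_mat m \<Longrightarrow> 0 \<le> opnorm m"
  using entry_le_opnorm[of m undefined undefined] norm_ge_zero order_trans by blast

lemma form_bound_diff:
  assumes "form_bound a A" "form_bound b B"
  shows "form_bound (a - b) (A + B)"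
  unfolding form_bound_def
proof (intro allI impI)
  fix f g :: "'a \<Rightarrow> complex"
  assume fin: "finite (supp_v f)" "finite (supp_v g)"
  have "bform (a - b) g f = bform a g f - bform b g f"
    by (simp add: bform_def algebra_simps sum_subtractf)
  then have "cmod (bform (a - b) g f) \<le> cmod (bform a g f) + cmod (bform b g f)"
    by (simp add: norm_triangle_ineq4)
  also have "\<dots> \<le> A * l2norm f * l2norm g + B * l2norm f * l2norm g"
    using assms fin by (intro add_mono) (auto simp: form_bound_def)
  finally show "cmod (bform (a - b) g f) \<le> (A + B) * l2norm f * l2norm g"
    by (simp add: algebra_simps)
qed

lemma bounded_mat_diff: "bounded_mat a \<Longrightarrow> bounded_mat b \<Longrightarrow> bounded_mat (a - b)"
  using form_bound_diff bounded_mat_iff_form_bound by blast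

lemma form_bound_zero: "form_bound 0 0"
  by (simp add: form_bound_def bform_def)

lemma bounded_mat_zero: "bounded_mat 0"
  using form_bound_zero bounded_mat_iff_form_bound by blast

lemma opnorm_zero: "opnorm 0 \<le> 0"
  by (rule opnorm_le[OF form_bound_zero]) simp

lemma bounded_mat_add:
  assumes "bounded_mat a" "bounded_mat b"
  shows "bounded_mat (a + b)"
proof -
  have "a + b = a - (0 - b)" by simp
  then show ?thesis using assms bounded_mat_diff bounded_mat_zero by metis
qed

lemma bounded_mat_sum:
  "finite I \<Longrightarrow> (\<And>i. i \<in> I \<Longrightarrow> bounded_mat (a i)) \<Longrightarrow> bounded_mat (\<Sum>i\<in>I. a i)"
  by (induction I rule: finite_induct) (simp_all add: bounded_mat_zero bounded_mat_add)

lemma sum_mat_apply: "(\<Sum>i\<in>I. a i) y x = (\<Sum>i\<in>I. a i y x)"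
  for a :: "'i \<Rightarrow> 'a mat"
  by (induction I rule: infinite_finite_induct) auto

section \<open>Schur test and products of matrices\<close>

text \<open>Apply Cauchy-Schwarz to the sum over index pairs with nonzero entry. Each coordinate of
  \<open>g\<close>, and likewise of \<open>f\<close>, occurs in at most \<open>N\<close> such pairs,
  so each of the two factors costs \<open>sqrt N\<close>.\<close>

lemma form_bound_schur:
  assumes C: "\<And>y x. cmod (m y x) \<le> C"
    and row: "\<And>y. finite {x. m y x \<noteq> 0}" "\<And>y. card {x. m y x \<noteq> 0} \<le> N"
    and col: "\<And>x. finite {y. m y x \<noteq> 0}" "\<And>x. card {y. m y x \<noteq> 0} \<le> N"
  shows "form_bound m (C * real N)"
  unfolding form_bound_def
proof (intro allI impI)
  fix f g :: "'a \<Rightarrow> complex"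
  assume fin: "finite (supp_v f)" "finite (supp_v g)"
  let ?S = "supp_v f" and ?T = "supp_v g"
  have C0: "0 \<le> C" using C[of undefined undefined] norm_ge_zero order_trans by blast
  define P where "P = (SIGMA y:?T. {x\<in>?S. m y x \<noteq> 0})"
  define Q where "Q = (SIGMA x:?S. {y\<in>?T. m y x \<noteq> 0})"
  have finP: "finite P" unfolding P_def using fin by auto
  \<comment> \<open>\<open>P\<close> lists the pairs by rows and \<open>Q\<close> by columns; the
    \<open>g\<close>-factor is counted along rows, the \<open>f\<close>-factor along
    columns.\<close>
  have PQ: "bij_betw prod.swap Q P"
    by (rule bij_betwI[where g = prod.swap]) (auto simp: P_def Q_def)
  have "bform m g f = (\<Sum>y\<in>?T. \<Sum>x\<in>{x\<in>?S. m y x \<noteq> 0}. cnj (g y) * m y x * f x)"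
    unfolding bform_def by (intro sum.cong refl sum.mono_neutral_right) (use fin in auto)
  also have "\<dots> = (\<Sum>(y,x)\<in>P. cnj (g y) * m y x * f x)"
    unfolding P_def by (rule sum.Sigma) (use fin in auto)
  finally have "cmod (bform m g f) \<le> (\<Sum>(y,x)\<in>P. cmod (cnj (g y) * m y x * f x))"
    by (simp add: case_prod_unfold norm_sum)
  also have "\<dots> \<le> (\<Sum>(y,x)\<in>P. C * (\<bar>cmod (g y)\<bar> * \<bar>cmod (f x)\<bar>))"
  proof (rule sum_mono, clarify)
    fix y x
    have "cmod (m y x) * (cmod (g y) * cmod (f x)) \<le> C * (cmod (g y) * cmod (f x))"
      using C by (intro mult_right_mono) auto
    then show "cmod (cnj (g y) * m y x * f x) \<le> C * (\<bar>cmod (g y)\<bar> * \<bar>cmod (f x)\<bar>)"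
      by (simp add: norm_mult mult_ac)
  qed
  also have "\<dots> = C * (\<Sum>p\<in>P. \<bar>cmod (g (fst p))\<bar> * \<bar>cmod (f (snd p))\<bar>)"
    by (simp add: case_prod_unfold sum_distrib_left)
  also have "\<dots> \<le> C * (L2_set (\<lambda>p. cmod (g (fst p))) P * L2_set (\<lambda>p. cmod (f (snd p))) P)"
    using C0 by (intro mult_left_mono L2_set_mult_ineq)
  also have "\<dots> \<le> C * ((sqrt N * l2norm g) * (sqrt N * l2norm f))"
  proof (intro mult_left_mono mult_mono C0)
    have "(\<Sum>p\<in>P. (cmod (g (fst p)))\<^sup>2) = (\<Sum>y\<in>?T. \<Sum>x\<in>{x\<in>?S. m y x \<noteq> 0}. (cmod (g y))\<^sup>2)"
      unfolding P_def by (subst sum.Sigma) (use fin in \<open>auto simp: case_prod_unfold\<close>)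
    also have "\<dots> \<le> (\<Sum>y\<in>?T. real N * (cmod (g y))\<^sup>2)"
    proof (rule sum_mono)
      fix y
      have "card {x\<in>?S. m y x \<noteq> 0} \<le> card {x. m y x \<noteq> 0}"
        using row(1) by (intro card_mono) auto
      then have "card {x\<in>?S. m y x \<noteq> 0} \<le> N" using row(2) order_trans by blast
      then show "(\<Sum>x\<in>{x\<in>?S. m y x \<noteq> 0}. (cmod (g y))\<^sup>2) \<le> real N * (cmod (g y))\<^sup>2"
        by (simp add: mult_right_mono)
    qed
    finally show "L2_set (\<lambda>p. cmod (g (fst p))) P \<le> sqrt N * l2norm g"
      using fin by (simp add: l2norm_eq_L2_set[of ?T] L2_set_def sum_distrib_left[symmetric]
          real_sqrt_mult[symmetric])
    have "(\<Sum>p\<in>P. (cmod (f (snd p)))\<^sup>2) = (\<Sum>p\<in>Q. (cmod (f (fst p)))\<^sup>2)"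
      by (subst sum.reindex_bij_betw[OF PQ, symmetric]) (simp add: case_prod_unfold)
    also have "\<dots> = (\<Sum>x\<in>?S. \<Sum>y\<in>{y\<in>?T. m y x \<noteq> 0}. (cmod (f x))\<^sup>2)"
      unfolding Q_def by (subst sum.Sigma) (use fin in \<open>auto simp: case_prod_unfold\<close>)
    also have "\<dots> \<le> (\<Sum>x\<in>?S. real N * (cmod (f x))\<^sup>2)"
    proof (rule sum_mono)
      fix x
      have "card {y\<in>?T. m y x \<noteq> 0} \<le> card {y. m y x \<noteq> 0}"
        using col(1) by (intro card_mono) auto
      then have "card {y\<in>?T. m y x \<noteq> 0} \<le> N" using col(2) order_trans by blast
      then show "(\<Sum>y\<in>{y\<in>?T. m y x \<noteq> 0}. (cmod (f x))\<^sup>2) \<le> real N * (cmod (f x))\<^sup>2"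
        by (simp add: mult_right_mono)
    qed
    finally show "L2_set (\<lambda>p. cmod (f (snd p))) P \<le> sqrt N * l2norm f"
      using fin by (simp add: l2norm_eq_L2_set[of ?S] L2_set_def sum_distrib_left[symmetric]
          real_sqrt_mult[symmetric])
  qed (auto simp: L2_set_nonneg)
  also have "\<dots> = C * real N * l2norm f * l2norm g"
    by simp
  finally show "cmod (bform m g f) \<le> C * real N * l2norm f * l2norm g" .
qed

text \<open>The infinite sum in \<open>mmult\<close> has value 0 when it is not summable; finite
  support of the row of \<open>c\<close> excludes this.\<close>

lemma mmult_row_finite:
  assumes "finite S" "\<And>z. c y z \<noteq> 0 \<Longrightarrow> z \<in> S"
  shows "mmult c a y x = (\<Sum>z\<in>S. c y z * a z x)"
proof -
  have "mmult c a y x = (\<Sum>\<^sub>\<infinity>z\<in>S. c y z * a z x)"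
    unfolding mmult_def by (rule infsum_cong_neutral) (use assms in auto)
  then show ?thesis using assms(1) by simp
qed

text \<open>With row-finite \<open>c\<close>, the adjoint of \<open>c\<close> preserves finite supports, so that the form of
  \<open>c a\<close> at \<open>(g, f)\<close> is the form of \<open>a\<close> at \<open>(c\<^sup>* g, f)\<close>.\<close>

lemma form_bound_mmult:
  assumes fr: "\<And>y. finite {z. c y z \<noteq> 0}"
    and c: "form_bound c C" and a: "form_bound a A" and pos: "0 \<le> C" "0 \<le> A"
  shows "form_bound (mmult c a) (C * A)"
  unfolding form_bound_def
proof (intro allI impI)
  fix f g :: "'a \<Rightarrow> complex"
  assume fin: "finite (supp_v f)" "finite (supp_v g)"
  define S where "S = (\<Union>y\<in>supp_v g. {z. c y z \<noteq> 0})"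
  define h where "h = (\<lambda>z. \<Sum>y\<in>supp_v g. cnj (c y z) * g y)"
  have finS: "finite S" unfolding S_def using fr fin by auto
  have "h z = 0" if "z \<notin> S" for z
    unfolding h_def using that by (intro sum.neutral) (auto simp: S_def)
  then have hS: "supp_v h \<subseteq> S" by (auto simp: supp_v_def)
  then have finh: "finite (supp_v h)" using finS finite_subset by blast
  have "bform (mmult c a) g f
      = (\<Sum>y\<in>supp_v g. \<Sum>x\<in>supp_v f. \<Sum>z\<in>S. cnj (g y) * c y z * a z x * f x)"
    unfolding bform_def
  proof (intro sum.cong refl)
    fix y x assume "y \<in> supp_v g"
    then have "mmult c a y x = (\<Sum>z\<in>S. c y z * a z x)"
      by (intro mmult_row_finite finS) (auto simp: S_def)
    then show "cnj (g y) * mmult c a y x * f x = (\<Sum>z\<in>S. cnj (g y) * c y z * a z x * f x)"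
      by (simp add: sum_distrib_left sum_distrib_right mult_ac)
  qed
  also have "\<dots> = (\<Sum>y\<in>supp_v g. \<Sum>z\<in>S. \<Sum>x\<in>supp_v f. cnj (g y) * c y z * a z x * f x)"
    by (intro sum.cong refl sum.swap)
  also have "\<dots> = (\<Sum>z\<in>S. \<Sum>y\<in>supp_v g. \<Sum>x\<in>supp_v f. cnj (g y) * c y z * a z x * f x)"
    by (rule sum.swap)
  also have "\<dots> = (\<Sum>z\<in>S. \<Sum>x\<in>supp_v f. \<Sum>y\<in>supp_v g. cnj (g y) * c y z * a z x * f x)"
    by (intro sum.cong refl sum.swap)
  also have "\<dots> = (\<Sum>z\<in>S. \<Sum>x\<in>supp_v f. cnj (h z) * a z x * f x)"
    by (intro sum.cong refl) (simp add: h_def sum_distrib_right sum_distrib_left mult_ac)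
  also have "\<dots> = bform a h f"
    by (rule bform_eq_sum[symmetric]) (use fin finS hS in auto)
  finally have eq: "bform (mmult c a) g f = bform a h f" .
  \<comment> \<open>Here \<open>h\<close> is the adjoint of \<open>c\<close> applied to
    \<open>g\<close>. Pairing it with itself gives the form of \<open>c\<close> at
    \<open>(g, h)\<close>, so its squared norm is at most \<open>C * l2norm h * l2norm g\<close>;
    cancelling one factor bounds \<open>h\<close> by \<open>C * l2norm g\<close>.\<close>
  have "complex_of_real ((l2norm h)\<^sup>2) = (\<Sum>z\<in>S. cnj (h z) * h z)"
    using finS hS
    by (simp add: l2norm_eq_L2_set[of S] L2_set_def sum_nonneg complex_norm_square mult.commute
        del: of_real_power)
  also have "\<dots> = (\<Sum>z\<in>S. \<Sum>y\<in>supp_v g. cnj (g y) * c y z * h z)"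
  proof (rule sum.cong[OF refl])
    fix z
    have "cnj (h z) = (\<Sum>y\<in>supp_v g. cnj (g y) * c y z)"
      by (simp add: h_def mult_ac)
    then show "cnj (h z) * h z = (\<Sum>y\<in>supp_v g. cnj (g y) * c y z * h z)"
      by (simp add: sum_distrib_right)
  qed
  also have "\<dots> = (\<Sum>y\<in>supp_v g. \<Sum>z\<in>S. cnj (g y) * c y z * h z)"
    by (rule sum.swap)
  also have "\<dots> = bform c g h"
    by (rule bform_eq_sum[symmetric]) (use fin finS hS in auto)
  finally have "(l2norm h)\<^sup>2 = cmod (bform c g h)"
    by (metis abs_of_nonneg norm_of_real zero_le_power2)
  also have "\<dots> \<le> C * l2norm h * l2norm g"
    using c fin finh by (simp add: form_bound_def)
  finally have "l2norm h * l2norm h \<le> (C * l2norm g) * l2norm h"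
    by (simp add: power2_eq_square mult_ac)
  then have hle: "l2norm h \<le> C * l2norm g"
    using pos by (cases "l2norm h = 0") (auto simp: order.strict_iff_order)
  have "cmod (bform (mmult c a) g f) \<le> A * l2norm f * l2norm h"
    unfolding eq using a fin finh by (simp add: form_bound_def)
  also have "\<dots> \<le> A * l2norm f * (C * l2norm g)"
    using pos hle by (intro mult_left_mono) auto
  finally show "cmod (bform (mmult c a) g f) \<le> C * A * l2norm f * l2norm g"
    by (simp add: mult_ac)
qed

lemma bounded_mat_mmult:
  assumes "\<And>y. finite {z. c y z \<noteq> 0}" "bounded_mat c" "bounded_mat a"
  shows "bounded_mat (mmult c a)"
  unfolding bounded_mat_iff_form_bound
  by (intro exI, rule form_bound_mmult[OF _ form_bound_opnorm form_bound_opnorm])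
    (use assms in \<open>auto intro: opnorm_nonneg\<close>)

section \<open>Uniform local finiteness and band matrices in the Roe algebra\<close>

lemma ulfD:
  assumes "ulf TYPE('a::metric_space)"
  shows "\<exists>N>0. \<forall>x::'a. finite (cball x r) \<and> card (cball x r) \<le> N"
proof -
  \<comment> \<open>\<open>ulf\<close> controls only positive radii, so \<open>r\<close> is
    enlarged; \<open>Suc N\<close> below makes the bound positive.\<close>
  have "0 < max r 1" by simp
  then obtain N :: nat where N: "\<forall>x::'a. finite (cball x (max r 1)) \<and> card (cball x (max r 1)) \<le> N"
    using assms unfolding ulf_def by blast
  have "finite (cball x r) \<and> card (cball x r) \<le> Suc N" for x :: 'a
  proof -
    have sub: "cball x r \<subseteq> cball x (max r 1)" by auto
    have fin: "finite (cball x (max r 1))" using N by blast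
    have "card (cball x r) \<le> card (cball x (max r 1))" by (rule card_mono[OF fin sub])
    also have "\<dots> \<le> N" using N by blast
    finally show ?thesis using finite_subset[OF sub fin] by simp
  qed
  then show ?thesis by blast
qed

text \<open>Each row and each column is supported in a ball of radius \<open>k\<close>, so the ball
  cardinality serves as the Schur constant.\<close>

lemma form_bound_band:
  fixes m :: "'a::metric_space mat"
  assumes "propg_le m k" and C: "\<And>y x. cmod (m y x) \<le> C"
    and N: "\<And>x::'a. finite (cball x k)" "\<And>x::'a. card (cball x k) \<le> N"
  shows "form_bound m (C * real N)"
proof (rule form_bound_schur)
  have row: "{x. m y x \<noteq> 0} \<subseteq> cball y k" and col: "{x. m x y \<noteq> 0} \<subseteq> cball y k" for y
    using assms(1) by (auto simp: propg_le_def) (metis dist_commute)+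
  show "finite {x. m y x \<noteq> 0}" "finite {x. m x y \<noteq> 0}" for y
    by (rule finite_subset[OF row N(1)], rule finite_subset[OF col N(1)])
  show "card {x. m y x \<noteq> 0} \<le> N" "card {x. m x y \<noteq> 0} \<le> N" for y
    by (rule order_trans[OF card_mono[OF N(1) row] N(2)],
        rule order_trans[OF card_mono[OF N(1) col] N(2)])
qed (rule C)

lemma roe_finite_propg:
  assumes "bounded_mat m" "propg_le m k"
  shows "m \<in> roe"
proof -
  have "opnorm (m - m) \<le> 0" using opnorm_zero by simp
  then show ?thesis unfolding roe_def finite_propg_def using assms order_trans less_imp_le
    by blast
qed

lemma roe_band:
  fixes m :: "'a::metric_space mat"
  assumes "ulf TYPE('a)" "propg_le m k" "\<And>y x. cmod (m y x) \<le> C"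
  shows "m \<in> roe"
proof -
  obtain N :: nat where "\<And>x::'a. finite (cball x k)" "\<And>x::'a. card (cball x k) \<le> N"
    using ulfD[OF assms(1), of k] by blast
  then have "form_bound m (C * real N)" using form_bound_band assms by blast
  then show ?thesis using roe_finite_propg assms(2) bounded_mat_iff_form_bound by blast
qed

text \<open>The propagation bound is made positive because \<open>coarse_map\<close> and
  \<open>K_cocoarse\<close> constrain only nonnegative and positive distances respectively.\<close>

lemma roe_approx:
  assumes "m \<in> roe" "0 < \<epsilon>"
  shows "\<exists>b k. bounded_mat b \<and> propg_le b k \<and> 0 < k \<and> opnorm (m - b) \<le> \<epsilon>"
proof -
  obtain b k where b: "bounded_mat b" "propg_le b k" "opnorm (m - b) \<le> \<epsilon>"
    using assms unfolding roe_def finite_propg_def by blast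
  moreover have "propg_le b (max k 1)" using b(2) by (force simp: propg_le_def)
  moreover have "0 < max k 1" by simp
  ultimately show ?thesis by blast
qed

text \<open>An approximant of propagation \<open>k\<close> vanishes beyond distance
  \<open>k\<close>, so the entry of \<open>m\<close> there is an entry of the error and is bounded
  by its norm.\<close>

lemma roe_entries_small:
  assumes "m \<in> roe" "0 < \<epsilon>"
  shows "\<exists>k>0. \<forall>y x. k < dist x y \<longrightarrow> cmod (m y x) \<le> \<epsilon>"
proof -
  obtain b k where b: "bounded_mat b" "propg_le b k" "0 < k" "opnorm (m - b) \<le> \<epsilon>"
    using roe_approx[OF assms] by blast
  have "cmod (m y x) \<le> \<epsilon>" if "k < dist x y" for y x
  proof -
    have "b y x = 0" using that b(2) by (force simp: propg_le_def)
    moreover have "cmod ((m - b) y x) \<le> opnorm (m - b)"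
      using assms b(1) by (intro entry_le_opnorm bounded_mat_diff) (auto simp: roe_def)
    ultimately show ?thesis using b(4) by simp
  qed
  then show ?thesis using b(3) by blast
qed

section \<open>Relabelling by a bijection: from coarse quotients to embeddings\<close>

text \<open>For bijective \<open>f\<close>, \<open>pull_mat (inv f)\<close> is conjugation by the
  permutation unitary sending the basis vector at \<open>x\<close> to the one at \<open>f x\<close>.
  Working on indices avoids infinite sums.\<close>

definition pull_mat :: "('b \<Rightarrow> 'a) \<Rightarrow> 'a mat \<Rightarrow> 'b mat" where
  "pull_mat g a = (\<lambda>y x. a (g y) (g x))"

lemma form_bound_pull_mat:
  fixes g :: "'a \<Rightarrow> 'b"
  assumes g: "bij g" and a: "form_bound a C"
  shows "form_bound (pull_mat g a) C"
  unfolding form_bound_def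
proof (intro allI impI)
  fix h k :: "'a \<Rightarrow> complex"
  assume fin: "finite (supp_v h)" "finite (supp_v k)"
  define h' where "h' = h \<circ> inv g"
  define k' where "k' = k \<circ> inv g"
  have ig: "inv g (g x) = x" for x using g by (simp add: bij_is_inj)
  have gi: "g (inv g y) = y" for y using g by (simp add: bij_is_surj surj_f_inv_f)
  have hg: "h' (g x) = h x" "k' (g x) = k x" for x by (simp_all add: h'_def k'_def ig)
  have s: "supp_v h' = g ` supp_v h" "supp_v k' = g ` supp_v k"
    unfolding supp_v_def h'_def k'_def by (auto simp: ig image_iff) (metis gi)+
  have inj: "inj_on g A" for A using g bij_is_inj inj_on_subset by blast
  have "bform a k' h' = bform (pull_mat g a) k h"
    unfolding bform_def s pull_mat_def by (simp add: sum.reindex[OF inj] hg)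
  moreover have "l2norm h' = l2norm h" "l2norm k' = l2norm k"
    using fin s
    by (simp_all add: l2norm_eq_L2_set[of "g ` supp_v h"] l2norm_eq_L2_set[of "supp_v h"]
        l2norm_eq_L2_set[of "g ` supp_v k"] l2norm_eq_L2_set[of "supp_v k"]
        L2_set_def sum.reindex[OF inj] hg)
  moreover have "cmod (bform a k' h') \<le> C * l2norm h' * l2norm k'"
    using a fin s by (simp add: form_bound_def)
  ultimately show "cmod (bform (pull_mat g a) k h) \<le> C * l2norm h * l2norm k" by simp
qed

lemma bounded_mat_pull_mat: "bij g \<Longrightarrow> bounded_mat a \<Longrightarrow> bounded_mat (pull_mat g a)"
  unfolding bounded_mat_iff_form_bound by (blast intro: form_bound_pull_mat)

lemma opnorm_pull_mat: "bij g \<Longrightarrow> bounded_mat a \<Longrightarrow> opnorm (pull_mat g a) \<le> opnorm a"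
  by (rule opnorm_le[OF form_bound_pull_mat[OF _ form_bound_opnorm] opnorm_nonneg])

text \<open>Relabelling does not increase norms, and coarseness turns propagation at most
  \<open>k\<close> into propagation at most some \<open>M\<close>, so approximants go to
  approximants.\<close>

lemma roe_pull_mat:
  fixes f :: "'a::metric_space \<Rightarrow> 'b::metric_space"
  assumes f: "bij f" "coarse_map f" and a: "a \<in> roe"
  shows "pull_mat (inv f) a \<in> roe"
  unfolding roe_def
proof (intro CollectI conjI allI impI)
  have g: "bij (inv f)" using f(1) by (rule bij_imp_bij_inv)
  have fg: "f (inv f y) = y" for y using f(1) by (simp add: bij_is_surj surj_f_inv_f)
  have ba: "bounded_mat a" using a by (simp add: roe_def)
  then show "bounded_mat (pull_mat (inv f) a)" by (rule bounded_mat_pull_mat[OF g])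
  fix \<epsilon> :: real assume "0 < \<epsilon>"
  then obtain b k where b: "bounded_mat b" "propg_le b k" "0 < k" "opnorm (a - b) \<le> \<epsilon>"
    using roe_approx[OF a] by blast
  obtain M where M: "\<forall>x y. dist x y \<le> k \<longrightarrow> dist (f x) (f y) \<le> M"
    using f(2) b(3) less_imp_le unfolding coarse_map_def by metis
  have "propg_le (pull_mat (inv f) b) M"
    unfolding propg_le_def pull_mat_def using b(2) M fg by (metis propg_le_def)
  moreover have "opnorm (pull_mat (inv f) a - pull_mat (inv f) b) \<le> \<epsilon>"
  proof -
    have "pull_mat (inv f) a - pull_mat (inv f) b = pull_mat (inv f) (a - b)"
      by (simp add: pull_mat_def fun_eq_iff)
    then show ?thesis
      using opnorm_pull_mat[OF g bounded_mat_diff[OF ba b(1)]] b(4) by simp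
  qed
  ultimately show "\<exists>b. bounded_mat b \<and> finite_propg b \<and> opnorm (pull_mat (inv f) a - b) \<le> \<epsilon>"
    using bounded_mat_pull_mat[OF g b(1)] unfolding finite_propg_def by blast
qed

lemma pull_mat_inverse:
  assumes "bij f"
  shows "pull_mat f (pull_mat (inv f) a) = a" "pull_mat (inv f) (pull_mat f b) = b"
  using assms by (simp_all add: pull_mat_def bij_is_inj bij_is_surj surj_f_inv_f)

text \<open>A bijective change of the summation index preserves \<open>infsum\<close> whether or not
  the family is summable.\<close>

lemma mmult_pull_mat:
  assumes "bij g"
  shows "pull_mat g (mmult a b) = mmult (pull_mat g a) (pull_mat g b)"
proof (intro ext)
  fix y x
  show "pull_mat g (mmult a b) y x = mmult (pull_mat g a) (pull_mat g b) y x"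
    using infsum_reindex_bij_betw[OF assms, of "\<lambda>z. a (g y) z * b z (g x)"]
    by (simp add: pull_mat_def mmult_def)
qed

lemma roe_embedding_pull_mat:
  fixes f :: "'a::metric_space \<Rightarrow> 'b::metric_space"
  assumes "bij f" "coarse_map f"
  shows "roe_embedding (pull_mat (inv f))"
  unfolding roe_embedding_def
proof (intro conjI ballI allI)
  show "pull_mat (inv f) ` roe \<subseteq> roe" using roe_pull_mat[OF assms] by blast
  show "inj_on (pull_mat (inv f)) roe"
    using pull_mat_inverse(1)[OF assms(1)] by (metis inj_onI)
  show "pull_mat (inv f) (mmult a b) = mmult (pull_mat (inv f) a) (pull_mat (inv f) b)" for a b
    by (rule mmult_pull_mat[OF bij_imp_bij_inv[OF assms(1)]])
qed (simp_all add: pull_mat_def mscale_def madj_def fun_eq_iff)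

lemma diag_ops_pull_mat:
  assumes "bij g" "a \<in> diag_ops"
  shows "pull_mat g a \<in> diag_ops"
proof -
  have "bounded_mat (pull_mat g a)"
    using assms by (intro bounded_mat_pull_mat) (auto simp: diag_ops_def)
  moreover have "pull_mat g a y x = 0" if "x \<noteq> y" for x y
    using assms that injD[OF bij_is_inj[OF assms(1)], of x y]
    by (auto simp: diag_ops_def pull_mat_def)
  ultimately show ?thesis by (simp add: diag_ops_def)
qed

lemma image_diag_ops_pull_mat:
  assumes "bij f"
  shows "pull_mat (inv f) ` diag_ops = diag_ops"
proof (intro equalityI subsetI)
  fix b :: "'b mat" assume "b \<in> diag_ops"
  then have "pull_mat f b \<in> diag_ops" by (rule diag_ops_pull_mat[OF assms])
  then show "b \<in> pull_mat (inv f) ` diag_ops"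
    using pull_mat_inverse(2)[OF assms] by (metis imageI)
qed (use diag_ops_pull_mat[OF bij_imp_bij_inv[OF assms]] in blast)

text \<open>Co-coarseness lets every step \<open>y' \<rightarrow> y\<close> of length at most \<open>r\<close> be made in two steps
  \<open>y' \<rightarrow> \<zeta> y y' \<rightarrow> y\<close>, the first coming from a step of length at most \<open>\<delta>\<close> in the domain and the
  second of length at most \<open>K + 1\<close>. Splitting the steps according to the position \<open>q\<close> of \<open>y'\<close> in an
  enumeration of the \<open>\<delta>\<close>-ball around \<open>\<zeta> y y'\<close> factorises a matrix of propagation \<open>r\<close>.\<close>

lemma cobounded_elt_band:
  fixes f :: "'a::metric_space \<Rightarrow> 'b::metric_space"
  assumes ulf: "ulf TYPE('a)" "ulf TYPE('b)"
    and f: "bij f" "K_cocoarse K f"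
    and b: "bounded_mat b" "propg_le b r" "0 < r" and \<epsilon>: "0 \<le> \<epsilon>" "opnorm (d - b) \<le> \<epsilon>"
  shows "\<exists>l>0. cobounded_elt (pull_mat (inv f) ` roe) \<epsilon> (K + 1) l d"
proof -
  define g where "g = inv f"
  have fg: "f (g y) = y" for y using f(1) by (simp add: g_def bij_is_surj surj_f_inv_f)
  have gf: "g (f x) = x" for x using f(1) by (simp add: g_def bij_is_inj)
  have bg: "bij g" unfolding g_def using f(1) by (rule bij_imp_bij_inv)
  obtain \<delta> where \<delta>: "\<delta> > 0" "\<And>x. cball (f x) r \<subseteq> nbhd (f ` cball x \<delta>) K"
    using f(2) b(3) unfolding K_cocoarse_def by metis
  obtain N where N: "N > 0" "\<And>x::'a. finite (cball x \<delta>)" "\<And>x::'a. card (cball x \<delta>) \<le> N"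
    using ulfD[OF ulf(1), of \<delta>] by blast
  obtain N' where N': "N' > 0" "\<And>x::'b. finite (cball x (K+1))" "\<And>x::'b. card (cball x (K+1)) \<le> N'"
    using ulfD[OF ulf(2), of "K + 1"] by blast
  \<comment> \<open>The infimum defining the distance to the image need not be attained; allowing
    \<open>K + 1\<close> leaves room for an actual point. This is the origin of the propagation
    \<open>K + 1\<close>.\<close>
  have ex: "\<exists>z. dist y z \<le> K + 1 \<and> dist (g z) (g y') \<le> \<delta>" if "dist y' y \<le> r" for y y'
  proof -
    let ?A = "f ` cball (g y') \<delta>"
    have "infdist y ?A \<le> K" using \<delta>(2)[of "g y'"] that by (auto simp: fg nbhd_def)
    moreover have "?A \<noteq> {}" using \<delta>(1) by auto
    ultimately have "(INF a\<in>?A. dist y a) < K + 1" by (simp add: infdist_notempty)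
    then obtain z where "z \<in> ?A" "dist y z < K + 1"
      using \<open>?A \<noteq> {}\<close> by (subst (asm) cINF_less_iff) auto
    then show ?thesis by (auto simp: gf dist_commute intro!: exI[of _ z])
  qed
  define \<zeta> where "\<zeta> = (\<lambda>y y'. SOME z. dist y z \<le> K + 1 \<and> dist (g z) (g y') \<le> \<delta>)"
  have \<zeta>: "dist y (\<zeta> y y') \<le> K + 1" "dist (g (\<zeta> y y')) (g y') \<le> \<delta>"
    if "dist y' y \<le> r" for y y'
    using someI_ex[OF ex[OF that]] by (auto simp: \<zeta>_def)
  have "\<exists>en. \<forall>w::'a. bij_betw (en w) {0..<card (cball w \<delta>)} (cball w \<delta>)"
    by (intro choice allI ex_bij_betw_nat_finite N(2))
  then obtain en where en: "\<And>w::'a. bij_betw (en w) {0..<card (cball w \<delta>)} (cball w \<delta>)"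
    by blast
  define a where
    "a = (\<lambda>q w x. if q < card (cball w \<delta>) \<and> x = en w q then 1 else 0 :: complex)"
  \<comment> \<open>The pair \<open>(z, q)\<close> determines the column
    \<open>y' = f (en (g z) q)\<close>. The value \<open>b y y'\<close> is placed at
    \<open>z\<close> only when \<open>z\<close> is the midpoint chosen for \<open>(y, y')\<close>,
    so no value is used twice.\<close>
  define c where
    "c = (\<lambda>q y z. if q < card (cball (g z) \<delta>) \<and> \<zeta> y (f (en (g z) q)) = z
      then b y (f (en (g z) q)) else 0)"
  have pa: "propg_le (a q) \<delta>" for q
    using bij_betw_apply[OF en] by (auto simp: propg_le_def a_def dist_commute)
  have fa: "form_bound (a q) (1 * real N)" for q
    by (rule form_bound_band[OF pa _ N(2,3)]) (simp add: a_def)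
  have ra: "a q \<in> roe" for q
    by (rule roe_band[OF ulf(1) pa, of _ 1]) (simp add: a_def)
  have pc: "propg_le (c q) (K + 1)" for q
    unfolding propg_le_def
  proof (intro allI impI)
    fix z y assume "c q y z \<noteq> 0"
    then have z: "\<zeta> y (f (en (g z) q)) = z" and "b y (f (en (g z) q)) \<noteq> 0"
      by (auto simp: c_def split: if_splits)
    then have "dist (f (en (g z) q)) y \<le> r" using b(2) by (simp add: propg_le_def)
    from \<zeta>(1)[OF this] show "dist z y \<le> K + 1" by (simp add: z dist_commute)
  qed
  have ce: "cmod (c q y z) \<le> opnorm b" for q y z
    using entry_le_opnorm[OF b(1)] opnorm_nonneg[OF b(1)] by (simp add: c_def)
  have fc: "form_bound (c q) (opnorm b * real N')" for q
    by (rule form_bound_band[OF pc ce N'(2,3)])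
  have rc: "c q \<in> roe" for q
    by (rule roe_band[OF ulf(2) pc ce])
  \<comment> \<open>In \<open>cobounded_elt\<close> one number bounds everything: it must reach the
    number \<open>N\<close> of enumeration positions, the norms of the \<open>a q\<close> (at most
    \<open>N\<close>), and those of the \<open>c q\<close> (at most \<open>opnorm b * N'\<close>).
    Surplus summands vanish.\<close>
  obtain l where l: "N \<le> l" "opnorm b * real N' \<le> real l"
    by (metis max.bounded_iff of_nat_le_iff real_arch_simple)
  \<comment> \<open>In the sum over \<open>z\<close> only \<open>z = \<zeta> y y'\<close> can
    contribute, since \<open>a q\<close> forces \<open>y'\<close> to be the \<open>q\<close>-th
    point.\<close>
  have prod: "mmult (c q) (pull_mat g (a q)) y y'
      = (if q < card (cball (g (\<zeta> y y')) \<delta>) \<and> g y' = en (g (\<zeta> y y')) q then b y y' else 0)"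
    (is "_ = ?R") for q y y'
  proof -
    have "mmult (c q) (pull_mat g (a q)) y y' = (\<Sum>\<^sub>\<infinity>z\<in>{\<zeta> y y'}. c q y z * a q (g z) (g y'))"
      unfolding mmult_def pull_mat_def
      by (rule infsum_cong_neutral) (auto simp: c_def a_def fg split: if_splits, metis fg)
    also have "\<dots> = ?R" by (auto simp: c_def a_def) (metis fg)+
    finally show ?thesis .
  qed
  have "(\<Sum>q<l. mmult (c q) (pull_mat g (a q))) y y' = b y y'" for y y'
  proof (cases "b y y' = 0")
    case True
    then show ?thesis unfolding sum_mat_apply prod True by (intro sum.neutral) simp
  next
    case False
    let ?w = "g (\<zeta> y y')"
    have "dist y' y \<le> r" using False b(2) by (simp add: propg_le_def)
    then have "g y' \<in> cball ?w \<delta>" using \<zeta>(2) by simp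
    then obtain p where p: "p < card (cball ?w \<delta>)" "g y' = en ?w p"
      using en[of ?w] unfolding bij_betw_def by (metis atLeastLessThan_iff imageE)
    \<comment> \<open>The enumeration is injective, so exactly one \<open>q\<close> recovers the
      entry.\<close>
    have "q < card (cball ?w \<delta>) \<and> g y' = en ?w q \<longleftrightarrow> q = p" for q
      using p en[of ?w] by (auto simp: bij_betw_def inj_on_def)
    then have "(\<Sum>q<l. mmult (c q) (pull_mat g (a q))) y y' = (\<Sum>q<l. if q = p then b y y' else 0)"
      by (simp add: sum_mat_apply prod)
    moreover have "p < l" using p(1) N(3)[of ?w] l(1) by linarith
    ultimately show ?thesis by simp
  qed
  then have eq: "(\<Sum>q<l. mmult (c q) (pull_mat g (a q))) = b" by (simp add: fun_eq_iff)
  have "opnorm (pull_mat g (a q)) \<le> real l" for q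
  proof -
    have "opnorm (pull_mat g (a q)) \<le> 1 * real N"
      by (rule opnorm_le[OF form_bound_pull_mat[OF bg fa]]) simp
    then show ?thesis using l(1) by linarith
  qed
  moreover have "opnorm (c q) \<le> real l" for q
    using opnorm_le[OF fc] opnorm_nonneg[OF b(1)] l(2) by (meson mult_nonneg_nonneg of_nat_0_le_iff order_trans)
  ultimately have "cobounded_elt (pull_mat g ` roe) \<epsilon> (K + 1) l d"
    unfolding cobounded_elt_def using ra rc pc \<epsilon> eq
    by (intro exI[of _ "\<lambda>q. pull_mat g (a q)"] exI[of _ c]) auto
  moreover have "l > 0" using N(1) l(1) by simp
  ultimately show ?thesis unfolding g_def by blast
qed

text \<open>The width \<open>K + 1\<close> depends on \<open>f\<close> alone, as coboundedness
  demands; only the number \<open>l\<close> varies with the approximant and thus with the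
  tolerance.\<close>

lemma cobounded_pull_mat:
  fixes f :: "'a::metric_space \<Rightarrow> 'b::metric_space"
  assumes "ulf TYPE('a)" "ulf TYPE('b)" "bij f" "cocoarse f"
  shows "cobounded (pull_mat (inv f) ` roe)"
proof -
  obtain K where K: "K > 0" "K_cocoarse K f" using assms(4) by (auto simp: cocoarse_def)
  have "\<exists>l>0. cobounded_elt (pull_mat (inv f) ` roe) \<epsilon> (K + 1) l b"
    if b: "b \<in> roe" "0 < \<epsilon>" for b \<epsilon>
  proof -
    obtain b' r where "bounded_mat b'" "propg_le b' r" "0 < r" "opnorm (b - b') \<le> \<epsilon>"
      using roe_approx[OF b] by blast
    then show ?thesis using cobounded_elt_band[OF assms(1-3) K(2)] b(2) by simp
  qed
  then show ?thesis unfolding cobounded_def using K(1) by (intro exI[of _ "K + 1"]) auto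
qed

lemma cobounded_imp_almost_cobounded:
  assumes "cobounded A" "0 < \<epsilon>"
  shows "almost_cobounded \<epsilon> A roe"
proof -
  obtain k where k: "k > 0" "\<And>b. b \<in> roe \<Longrightarrow> \<exists>l>0. cobounded_elt A \<epsilon> k l b"
    using assms unfolding cobounded_def by metis
  have "\<exists>l a c. (\<forall>i<l. a i \<in> A \<and> c i \<in> roe \<and> propg_le (c i) k)
      \<and> opnorm (b - (\<Sum>i<l::nat. mmult (c i) (a i))) \<le> \<epsilon>" if "b \<in> roe" for b
    using k(2)[OF that] unfolding cobounded_elt_def by blast
  then show ?thesis unfolding almost_cobounded_def using k(1) by blast
qed

section \<open>Matrix units\<close>

definition unit_mat :: "'a \<Rightarrow> 'a \<Rightarrow> 'a mat" where
  "unit_mat y x = (\<lambda>u v. if u = y \<and> v = x then 1 else 0)"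

lemma form_bound_unit_mat: "form_bound (unit_mat y x) 1"
proof -
  have *: "{v. unit_mat y x u v \<noteq> 0} \<subseteq> {x}" "{v. unit_mat y x v u \<noteq> 0} \<subseteq> {y}" for u
    by (auto simp: unit_mat_def)
  have "form_bound (unit_mat y x) (1 * real 1)"
  proof (rule form_bound_schur)
    show "finite {v. unit_mat y x u v \<noteq> 0}" "finite {v. unit_mat y x v u \<noteq> 0}" for u
      by (rule finite_subset[OF *(1)], simp, rule finite_subset[OF *(2)], simp)
    show "card {v. unit_mat y x u v \<noteq> 0} \<le> 1" "card {v. unit_mat y x v u \<noteq> 0} \<le> 1" for u
      using card_mono[OF _ *(1)] card_mono[OF _ *(2)] by simp_all
  qed (simp add: unit_mat_def)
  then show ?thesis by simp
qed

lemma bounded_mat_unit_mat: "bounded_mat (unit_mat y x)"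
  unfolding bounded_mat_iff_form_bound by (rule exI, rule form_bound_unit_mat)

lemma unit_mat_roe: "unit_mat y x \<in> roe"
  by (rule roe_finite_propg[OF bounded_mat_unit_mat, of _ _ "dist x y"])
    (auto simp: propg_le_def unit_mat_def)

lemma unit_mat_diag_ops: "unit_mat x x \<in> diag_ops"
  using bounded_mat_unit_mat[of x x] by (auto simp: diag_ops_def) (auto simp: unit_mat_def)

lemma diag_ops_roe: "diag_ops \<subseteq> (roe :: 'a::metric_space mat set)"
proof
  fix m :: "'a mat" assume "m \<in> diag_ops"
  then have "bounded_mat m" "propg_le m 0"
    by (auto simp: diag_ops_def propg_le_def)
  then show "m \<in> roe" by (rule roe_finite_propg)
qed

lemma mmult_unit_mat_left: "mmult (unit_mat u y) a = (\<lambda>v x. if v = u then a y x else 0)"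
proof (intro ext)
  fix v x
  have "mmult (unit_mat u y) a v x = (\<Sum>z\<in>{y}. unit_mat u y v z * a z x)"
    by (rule mmult_row_finite) (auto simp: unit_mat_def split: if_splits)
  then show "mmult (unit_mat u y) a v x = (if v = u then a y x else 0)"
    by (simp add: unit_mat_def)
qed

lemma mmult_unit_mat_right: "mmult a (unit_mat y x) = (\<lambda>u v. if v = x then a u y else 0)"
proof (intro ext)
  fix u v
  have "mmult a (unit_mat y x) u v = (\<Sum>\<^sub>\<infinity>z\<in>{y}. a u z * unit_mat y x z v)"
    unfolding mmult_def by (rule infsum_cong_neutral) (auto simp: unit_mat_def)
  then show "mmult a (unit_mat y x) u v = (if v = x then a u y else 0)"
    by (simp add: unit_mat_def)
qed

lemma mmult_mscale: "mmult (mscale c a) (mscale d b) = mscale (c * d) (mmult a b)"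
proof (intro ext)
  fix y x
  have "mmult (mscale c a) (mscale d b) y x = (\<Sum>\<^sub>\<infinity>z. (c * d) * (a y z * b z x))"
    by (simp add: mmult_def mscale_def mult_ac)
  also have "\<dots> = (c * d) * (\<Sum>\<^sub>\<infinity>z. a y z * b z x)"
    by (rule infsum_cmult_right')
  finally show "mmult (mscale c a) (mscale d b) y x = mscale (c * d) (mmult a b) y x"
    by (simp add: mmult_def mscale_def)
qed

lemma madj_mscale_unit_mat: "madj (mscale c (unit_mat y x)) = mscale (cnj c) (unit_mat x y)"
  by (auto simp: madj_def mscale_def unit_mat_def fun_eq_iff)

lemma mscale_unit_mat_entry: "mscale c (unit_mat y x) y x = c"
  by (simp add: mscale_def unit_mat_def)

text \<open>Compression by two diagonal units isolates a single entry in purely algebraic terms, so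
  an embedding can transport it.\<close>

lemma unit_mat_sandwich:
  "mmult (mmult (unit_mat y y) a) (unit_mat x x) = mscale (a y x) (unit_mat y x)"
  unfolding mmult_unit_mat_left mmult_unit_mat_right
  by (auto simp: mscale_def unit_mat_def fun_eq_iff)

text \<open>An embedding is multiplicative only on \<open>roe\<close>, so the inner product of the
  sandwich has to be placed there before the second multiplication.\<close>

lemma mmult_unit_mat_roe:
  assumes a: "a \<in> roe"
  shows "mmult (unit_mat y y) a \<in> roe"
  unfolding roe_def
proof (intro CollectI conjI allI impI)
  have fr: "finite {z. unit_mat y y u z \<noteq> 0}" for u
    by (rule finite_subset[of _ "{y}"]) (auto simp: unit_mat_def)
  note bu = bounded_mat_unit_mat[of y y]
  have ba: "bounded_mat a" using a by (simp add: roe_def)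
  show "bounded_mat (mmult (unit_mat y y) a)" by (rule bounded_mat_mmult[OF fr bu ba])
  fix \<epsilon> :: real assume "0 < \<epsilon>"
  then obtain b k where b: "bounded_mat b" "propg_le b k" "opnorm (a - b) \<le> \<epsilon>"
    using roe_approx[OF a] by blast
  have "propg_le (mmult (unit_mat y y) b) k"
    using b(2) by (auto simp: propg_le_def mmult_unit_mat_left)
  moreover have "mmult (unit_mat y y) a - mmult (unit_mat y y) b = mmult (unit_mat y y) (a - b)"
    by (auto simp: mmult_unit_mat_left fun_eq_iff)
  moreover have "opnorm (mmult (unit_mat y y) (a - b)) \<le> 1 * opnorm (a - b)"
    using bounded_mat_diff[OF ba b(1)]
    by (intro opnorm_le form_bound_mmult fr form_bound_unit_mat form_bound_opnorm)
      (simp_all add: opnorm_nonneg)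
  ultimately show "\<exists>b. bounded_mat b \<and> finite_propg b \<and> opnorm (mmult (unit_mat y y) a - b) \<le> \<epsilon>"
    using bounded_mat_mmult[OF fr bu b(1)] b(3) unfolding finite_propg_def
    by (intro exI[of _ "mmult (unit_mat y y) b"]) auto
qed

lemma unit_mat_nonzero: "unit_mat y x \<noteq> 0"
  by (auto simp: unit_mat_def fun_eq_iff)

lemma unit_mat_eq_iff: "unit_mat y x = unit_mat y' x' \<longleftrightarrow> y = y' \<and> x = x'"
proof
  assume "unit_mat y x = unit_mat y' x'"
  then have "unit_mat y x y x = unit_mat y' x' y x" by simp
  then show "y = y' \<and> x = x'" by (simp add: unit_mat_def split: if_splits)
qed simp

lemma zero_roe: "0 \<in> roe"
  by (rule roe_finite_propg[of _ 0]) (simp_all add: bounded_mat_zero propg_le_def)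

section \<open>Spatial form of diagonal-preserving embeddings\<close>

text \<open>The image \<open>p\<close> of a diagonal unit is a nonzero diagonal matrix; let
  \<open>p u u\<close> be nonzero. The unit at \<open>u\<close> is the image of some diagonal
  \<open>q\<close>, and \<open>q\<close> acts on the unit at \<open>x\<close> as a scalar. Hence
  cutting \<open>p\<close> down to \<open>u\<close> only rescales it, which makes \<open>p\<close> a
  multiple of the unit at \<open>u\<close>; idempotence makes the factor 1.\<close>

lemma roe_embedding_unit_mat:
  fixes \<Phi> :: "'a::metric_space mat \<Rightarrow> 'b::metric_space mat"
  assumes \<Phi>: "roe_embedding \<Phi>" "\<Phi> ` diag_ops = diag_ops"
  shows "\<exists>y. \<Phi> (unit_mat x x) = unit_mat y y"
proof -
  have inj: "inj_on \<Phi> roe"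
    and sc: "\<And>a c. a \<in> roe \<Longrightarrow> \<Phi> (mscale c a) = mscale c (\<Phi> a)"
    and mu: "\<And>a b. a \<in> roe \<Longrightarrow> b \<in> roe \<Longrightarrow> \<Phi> (mmult a b) = mmult (\<Phi> a) (\<Phi> b)"
    using \<Phi>(1) unfolding roe_embedding_def by auto
  let ?e = "unit_mat x x"
  define p where "p = \<Phi> ?e"
  have "\<Phi> (mscale 0 0) = mscale 0 (\<Phi> 0)" by (rule sc[OF zero_roe])
  then have z: "\<Phi> 0 = 0" by (simp add: mscale_def zero_fun_def)
  have pd: "p \<in> diag_ops" unfolding p_def \<Phi>(2)[symmetric] by (rule imageI[OF unit_mat_diag_ops])
  have "p \<noteq> 0"
  proof
    assume "p = 0"
    then have "\<Phi> ?e = \<Phi> 0" by (simp add: p_def z)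
    then have "?e = 0" by (rule inj_onD[OF inj _ unit_mat_roe zero_roe])
    then show False using unit_mat_nonzero by metis
  qed
  then obtain u v where "p u v \<noteq> 0" by (auto simp: fun_eq_iff)
  moreover from this have "v = u" using pd by (auto simp: diag_ops_def)
  ultimately have u: "p u u \<noteq> 0" by simp
  have "unit_mat u u \<in> \<Phi> ` diag_ops" unfolding \<Phi>(2) by (rule unit_mat_diag_ops)
  then obtain q where q: "q \<in> diag_ops" "\<Phi> q = unit_mat u u" by auto
  have qr: "q \<in> roe" using q(1) diag_ops_roe by blast
  have "mmult q ?e = mscale (q x x) ?e"
    using q(1) unfolding mmult_unit_mat_right
    by (auto simp: diag_ops_def mscale_def fun_eq_iff unit_mat_def)
  then have "mmult (unit_mat u u) p = mscale (q x x) p"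
    using mu[OF qr unit_mat_roe, of x x] sc[OF unit_mat_roe] q(2) by (simp add: p_def)
  moreover have "mmult (unit_mat u u) p = mscale (p u u) (unit_mat u u)"
    using pd unfolding mmult_unit_mat_left
    by (auto simp: diag_ops_def mscale_def fun_eq_iff unit_mat_def)
  ultimately have eq: "mscale (p u u) (unit_mat u u) = mscale (q x x) p" by simp
  \<comment> \<open>Comparing the entries at \<open>(u, u)\<close> identifies the scalar as
    1.\<close>
  then have "p u u = q x x * p u u" by (metis mscale_unit_mat_entry mscale_def)
  then have "q x x = 1" using u by simp
  then have eq: "p = mscale (p u u) (unit_mat u u)" using eq by (simp add: mscale_def)
  have "mmult ?e ?e = ?e" unfolding mmult_unit_mat_left by (auto simp: unit_mat_def fun_eq_iff)
  then have "mmult p p = p" using mu[OF unit_mat_roe unit_mat_roe] by (metis p_def)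
  moreover have "mmult p p u u = p u u * p u u"
    using mmult_row_finite[of "{u}" p u p u] pd by (auto simp: diag_ops_def)
  ultimately have "p u u = 1" using u by simp
  then have "p = unit_mat u u" using eq by (simp add: mscale_def)
  then show ?thesis unfolding p_def by blast
qed

text \<open>Transporting the sandwich identity expresses each entry of the image through the
  original entry and the image of one matrix unit. That image is a unimodular multiple
  \<open>\<mu>\<close> of a matrix unit, so moduli of entries survive even though phases may
  change.\<close>

lemma roe_embedding_spatial:
  fixes \<Phi> :: "'a::metric_space mat \<Rightarrow> 'b::metric_space mat"
  assumes \<Phi>: "roe_embedding \<Phi>" "\<Phi> ` diag_ops = diag_ops"
  obtains f where "bij f" "\<And>a y x. a \<in> roe \<Longrightarrow> cmod (\<Phi> a (f y) (f x)) = cmod (a y x)"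
proof -
  have inj: "inj_on \<Phi> roe"
    and sc: "\<And>a c. a \<in> roe \<Longrightarrow> \<Phi> (mscale c a) = mscale c (\<Phi> a)"
    and mu: "\<And>a b. a \<in> roe \<Longrightarrow> b \<in> roe \<Longrightarrow> \<Phi> (mmult a b) = mmult (\<Phi> a) (\<Phi> b)"
    and ad: "\<And>a. a \<in> roe \<Longrightarrow> \<Phi> (madj a) = madj (\<Phi> a)"
    using \<Phi>(1) unfolding roe_embedding_def by auto
  obtain f where f: "\<And>x. \<Phi> (unit_mat x x) = unit_mat (f x) (f x)"
    using roe_embedding_unit_mat[OF assms] by metis
  have sw: "mscale (\<Phi> a (f y) (f x)) (unit_mat (f y) (f x)) = mscale (a y x) (\<Phi> (unit_mat y x))"
    if "a \<in> roe" for a y x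
  proof -
    have "\<Phi> (mmult (mmult (unit_mat y y) a) (unit_mat x x))
        = mmult (mmult (unit_mat (f y) (f y)) (\<Phi> a)) (unit_mat (f x) (f x))"
      using that by (simp add: mu mmult_unit_mat_roe unit_mat_roe f)
    then show ?thesis by (simp add: unit_mat_sandwich sc[OF unit_mat_roe])
  qed
  define \<mu> where "\<mu> y x = \<Phi> (unit_mat y x) (f y) (f x)" for y x
  \<comment> \<open>This is \<open>sw\<close> for the matrix unit itself, whose
    \<open>(y, x)\<close> entry is 1.\<close>
  have U: "\<Phi> (unit_mat y x) = mscale (\<mu> y x) (unit_mat (f y) (f x))" for y x
    using sw[OF unit_mat_roe, of y x y x] by (simp add: \<mu>_def mscale_def unit_mat_def)
  have \<mu>1: "cmod (\<mu> y x) = 1" for y x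
  proof -
    have "madj (unit_mat y x) = unit_mat x y"
      by (auto simp: madj_def unit_mat_def fun_eq_iff)
    then have "\<Phi> (unit_mat x y) = madj (\<Phi> (unit_mat y x))" using ad[OF unit_mat_roe] by metis
    then have "\<Phi> (unit_mat x y) = mscale (cnj (\<mu> y x)) (unit_mat (f x) (f y))"
      by (simp add: U[of y x] madj_mscale_unit_mat)
    then have \<mu>c: "\<mu> x y = cnj (\<mu> y x)" by (simp add: \<mu>_def[of x y] mscale_def) (simp add: unit_mat_def)
    \<comment> \<open>Multiplying opposite units gives \<open>\<mu> x y * \<mu> y x = 1\<close>;
      since \<open>\<mu> x y\<close> is the conjugate of \<open>\<mu> y x\<close>, the modulus is
      1.\<close>
    have "mmult (unit_mat x y) (unit_mat y x) = unit_mat x x"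
      unfolding mmult_unit_mat_left by (auto simp: unit_mat_def fun_eq_iff)
    then have "unit_mat (f x) (f x) = mmult (\<Phi> (unit_mat x y)) (\<Phi> (unit_mat y x))"
      using mu[OF unit_mat_roe unit_mat_roe] f by metis
    also have "\<dots> = mscale (\<mu> x y * \<mu> y x) (mmult (unit_mat (f x) (f y)) (unit_mat (f y) (f x)))"
      unfolding U
      by (simp add: mmult_mscale)
    also have "\<dots> = mscale (\<mu> x y * \<mu> y x) (unit_mat (f x) (f x))"
      unfolding mmult_unit_mat_left by (auto simp: mscale_def unit_mat_def fun_eq_iff)
    finally have "unit_mat (f x) (f x) = mscale (\<mu> x y * \<mu> y x) (unit_mat (f x) (f x))" .
    from fun_cong[OF fun_cong[OF this, of "f x"], of "f x"] have "\<mu> x y * \<mu> y x = 1"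
      unfolding mscale_unit_mat_entry by (simp add: unit_mat_def)
    then have "cmod (\<mu> y x) * cmod (\<mu> y x) = 1"
      unfolding \<mu>c by (metis complex_mod_cnj norm_mult norm_one)
    then show ?thesis using norm_ge_zero[of "\<mu> y x"] by (simp add: square_eq_1_iff)
  qed
  have "inj f"
  proof (rule injI)
    fix x y assume "f x = f y"
    then have "\<Phi> (unit_mat x x) = \<Phi> (unit_mat y y)" by (simp add: f)
    then have "unit_mat x x = unit_mat y y" by (rule inj_onD[OF inj _ unit_mat_roe unit_mat_roe])
    then show "x = y" by (simp add: unit_mat_eq_iff)
  qed
  moreover have "\<exists>x. y = f x" for y
  proof -
    \<comment> \<open>Surjectivity: a diagonal preimage \<open>q\<close> of the unit at
      \<open>y\<close> has some nonzero \<open>q u u\<close>. By \<open>sw\<close> this is the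
      \<open>(f u, f u)\<close> entry of the unit at \<open>y\<close>, forcing
      \<open>f u = y\<close>.\<close>
    have "unit_mat y y \<in> \<Phi> ` diag_ops" unfolding \<Phi>(2) by (rule unit_mat_diag_ops)
    then obtain q where q: "q \<in> diag_ops" "\<Phi> q = unit_mat y y" by auto
    have qr: "q \<in> roe" using q(1) diag_ops_roe by blast
    have "\<Phi> (mscale 0 0) = mscale 0 (\<Phi> 0)" by (rule sc[OF zero_roe])
    then have "\<Phi> 0 = 0" by (simp add: mscale_def zero_fun_def)
    then have "q \<noteq> 0" using q(2) unit_mat_nonzero by metis
    then obtain u v where "q u v \<noteq> 0" by (auto simp: fun_eq_iff)
    moreover from this have "v = u" using q(1) by (auto simp: diag_ops_def)
    ultimately have u: "q u u \<noteq> 0" by simp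
    have "\<Phi> q (f u) (f u) = q u u"
      using sw[OF qr, of u u] unfolding f by (metis mscale_unit_mat_entry)
    then have "f u = y" using u q(2) by (auto simp: unit_mat_def split: if_splits)
    then show ?thesis by blast
  qed
  ultimately have "bij f" by (simp add: bij_def surj_def)
  moreover have "cmod (\<Phi> a (f y) (f x)) = cmod (a y x)" if "a \<in> roe" for a y x
  proof -
    have "\<Phi> a (f y) (f x) = a y x * \<mu> y x"
    proof -
      have "\<Phi> a (f y) (f x) = mscale (a y x) (\<Phi> (unit_mat y x)) (f y) (f x)"
        using sw[OF that, of y x] by (metis mscale_unit_mat_entry)
      then show ?thesis by (simp add: mscale_def \<mu>_def)
    qed
    then show ?thesis by (simp add: norm_mult \<mu>1)
  qed
  ultimately show thesis by (rule that)
qed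

section \<open>Coarseness and co-coarseness of the spatial bijection\<close>

definition band_mat :: "real \<Rightarrow> 'a::metric_space mat" where
  "band_mat r = (\<lambda>y x. if dist x y \<le> r then 1 else 0)"

lemma band_mat_roe: "ulf TYPE('a) \<Longrightarrow> band_mat r \<in> (roe :: 'a::metric_space mat set)"
  by (rule roe_band[of _ r 1]) (auto simp: propg_le_def band_mat_def)

text \<open>The image of \<open>band_mat t\<close> has entries of modulus 1 at
  \<open>(f y, f x)\<close> whenever \<open>dist x y\<close> is at most \<open>t\<close>, whereas
  far from the diagonal its entries are at most 1/2.\<close>

lemma coarse_map_if_spatial:
  fixes f :: "'a::metric_space \<Rightarrow> 'b::metric_space"
  assumes "ulf TYPE('a)" "\<Phi> ` roe \<subseteq> roe"
    and ent: "\<And>a y x. a \<in> roe \<Longrightarrow> cmod (\<Phi> a (f y) (f x)) = cmod (a y x)"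
  shows "coarse_map f"
  unfolding coarse_map_def
proof (intro allI impI)
  fix t :: real
  have B: "band_mat t \<in> (roe :: 'a mat set)" by (rule band_mat_roe[OF assms(1)])
  then have "\<Phi> (band_mat t) \<in> roe" using assms(2) by blast
  then obtain k where k: "\<And>y x. k < dist x y \<Longrightarrow> cmod (\<Phi> (band_mat t) y x) \<le> 1/2"
    using roe_entries_small[of _ "1/2"] by (metis half_gt_zero zero_less_one)
  have "dist (f x) (f y) \<le> k" if "dist x y \<le> t" for x y
    using k[of "f x" "f y"] ent[OF B, of y x] that by (auto simp: band_mat_def not_less[symmetric])
  then show "\<exists>M. \<forall>x y. dist x y \<le> t \<longrightarrow> dist (f x) (f y) \<le> M" by blast
qed

text \<open>The width \<open>k\<close> from almost coboundedness becomes the co-coarseness constant: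
  it is fixed before the matrix to be factored, hence independent of \<open>r\<close>.\<close>

lemma cocoarse_if_spatial:
  fixes f :: "'a::metric_space \<Rightarrow> 'b::metric_space"
  assumes ulf: "ulf TYPE('b)" and f: "bij f" and \<Phi>: "\<Phi> ` roe \<subseteq> roe"
    and ent: "\<And>a y x. a \<in> roe \<Longrightarrow> cmod (\<Phi> a (f y) (f x)) = cmod (a y x)"
    and ac: "almost_cobounded \<epsilon> (\<Phi> ` roe) roe" "\<epsilon> < 1"
  shows "cocoarse f"
proof -
  obtain k where k: "k > 0" and
    fac: "\<And>b. b \<in> roe \<Longrightarrow> \<exists>l. \<exists>a c. (\<forall>i<l::nat. a i \<in> \<Phi> ` roe \<and> c i \<in> roe \<and> propg_le (c i) k)
      \<and> opnorm (b - (\<Sum>i<l. mmult (c i) (a i))) \<le> \<epsilon>"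
    using ac(1) unfolding almost_cobounded_def by blast
  obtain N where N: "N > 0" "\<And>x::'b. finite (cball x k)" "\<And>x::'b. card (cball x k) \<le> N"
    using ulfD[OF ulf, of k] by blast
  have "\<exists>\<delta>>0. \<forall>x. cball (f x) r \<subseteq> nbhd (f ` cball x \<delta>) k" if "r > 0" for r
  proof -
    have B: "band_mat r \<in> (roe :: 'b mat set)" by (rule band_mat_roe[OF ulf])
    obtain l :: nat and a c where
      ai: "\<And>i. i < l \<Longrightarrow> a i \<in> \<Phi> ` roe" and
      ci: "\<And>i. i < l \<Longrightarrow> c i \<in> roe" "\<And>i. i < l \<Longrightarrow> propg_le (c i) k" and
      le: "opnorm (band_mat r - (\<Sum>i<l. mmult (c i) (a i))) \<le> \<epsilon>"
      using fac[OF B] by blast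
    have bc: "bounded_mat (c i)" and ba: "bounded_mat (a i)" if "i < l" for i
      using ai[OF that] ci(1)[OF that] \<Phi> by (auto simp: roe_def)
    have row: "finite {z. c i y z \<noteq> 0}" if "i < l" for i y
      by (rule finite_subset[OF _ N(2)[of y]])
        (use ci(2)[OF that] in \<open>auto simp: propg_le_def dist_commute\<close>)
    have bd: "bounded_mat (band_mat r - (\<Sum>i<l. mmult (c i) (a i)))"
    proof (rule bounded_mat_diff)
      show "bounded_mat (band_mat r :: 'b mat)" using B by (simp add: roe_def)
      show "bounded_mat (\<Sum>i<l. mmult (c i) (a i))"
        by (rule bounded_mat_sum) (auto intro!: bounded_mat_mmult row bc ba)
    qed
    define C where "C = 1 + (\<Sum>i<l. opnorm (c i))"
    have Cn: "0 \<le> (\<Sum>i<l. opnorm (c i))" by (rule sum_nonneg) (auto intro: opnorm_nonneg bc)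
    \<comment> \<open>Chosen so that \<open>C * (real N * \<eta>)\<close> equals
      \<open>(1 - \<epsilon>) / 2\<close>. The summand 1 in \<open>C\<close> keeps the denominator
      positive even if \<open>l = 0\<close>.\<close>
    define \<eta> where "\<eta> = (1 - \<epsilon>) / (2 * real N * C)"
    have C: "0 < C" using Cn by (simp add: C_def)
    have \<eta>: "0 < \<eta>" using ac(2) N(1) C by (simp add: \<eta>_def)
    have "\<exists>\<delta>>0. \<forall>y x. \<delta> < dist x y \<longrightarrow> cmod (a i (f y) (f x)) \<le> \<eta>" if i: "i < l" for i
    proof -
      obtain a' where a': "a' \<in> roe" "a i = \<Phi> a'" using ai[OF i] by blast
      obtain \<delta> where "0 < \<delta>" "\<And>y x. \<delta> < dist x y \<Longrightarrow> cmod (a' y x) \<le> \<eta>"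
        using roe_entries_small[OF a'(1) \<eta>] by blast
      then show ?thesis using ent[OF a'(1)] a'(2) by auto
    qed
    then obtain d where d: "\<And>i. i < l \<Longrightarrow> 0 < d i"
      "\<And>i y x. i < l \<Longrightarrow> d i < dist x y \<Longrightarrow> cmod (a i (f y) (f x)) \<le> \<eta>"
      by metis
    \<comment> \<open>A single radius exceeding every \<open>d i\<close>, positive also for an empty
      family.\<close>
    define \<delta> where "\<delta> = 1 + (\<Sum>i<l. d i)"
    have dn: "0 \<le> (\<Sum>i<l. d i)" by (rule sum_nonneg) (use d(1) less_imp_le in auto)
    have d\<delta>: "d i < \<delta>" if "i < l" for i
    proof -
      have "d i \<le> (\<Sum>i<l. d i)"
        by (rule member_le_sum) (use that d(1) less_imp_le in auto)
      then show ?thesis by (simp add: \<delta>_def)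
    qed
    have "infdist y (f ` cball x \<delta>) \<le> k" if y: "dist (f x) y \<le> r" for x y
    proof (rule ccontr)
      assume far: "\<not> infdist y (f ` cball x \<delta>) \<le> k"
      \<comment> \<open>Row \<open>y\<close> of \<open>c i\<close> lives on points \<open>z\<close>
        within \<open>k\<close> of \<open>y\<close>. If \<open>y\<close> is farther than
        \<open>k\<close> from the image of the ball, no such \<open>z\<close> lies in that image, so
        its preimage is farther than \<open>\<delta>\<close> from \<open>x\<close>.\<close>
      have small: "cmod (a i z (f x)) \<le> \<eta>" if "i < l" "dist y z \<le> k" for i z
      proof -
        obtain w where w: "z = f w" using f by (metis bij_pointE)
        have "\<delta> < dist x w"
        proof (rule ccontr)
          assume "\<not> \<delta> < dist x w"
          then have "z \<in> f ` cball x \<delta>" using w by auto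
          then show False using far that(2) infdist_le2 by metis
        qed
        then show ?thesis using d(2)[OF that(1), of x w] d\<delta>[OF that(1)] w by auto
      qed
      have prod: "cmod (mmult (c i) (a i) y (f x)) \<le> opnorm (c i) * (real N * \<eta>)" if i: "i < l" for i
      proof -
        have "mmult (c i) (a i) y (f x) = (\<Sum>z\<in>cball y k. c i y z * a i z (f x))"
          by (rule mmult_row_finite[OF N(2)])
            (use ci(2)[OF i] in \<open>auto simp: propg_le_def dist_commute\<close>)
        also have "cmod \<dots> \<le> (\<Sum>z\<in>cball y k. opnorm (c i) * \<eta>)"
        proof (rule sum_norm_le)
          fix z assume "z \<in> cball y k"
          then show "cmod (c i y z * a i z (f x)) \<le> opnorm (c i) * \<eta>"
            unfolding norm_mult using small[OF i] entry_le_opnorm[OF bc[OF i]] opnorm_nonneg[OF bc[OF i]]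
            by (intro mult_mono) auto
        qed
        also have "\<dots> = real (card (cball y k)) * (opnorm (c i) * \<eta>)" by simp
        also have "\<dots> \<le> real N * (opnorm (c i) * \<eta>)"
          using N(3) opnorm_nonneg[OF bc[OF i]] \<eta> by (intro mult_right_mono) auto
        finally show ?thesis by (simp add: mult_ac)
      qed
      have "cmod ((\<Sum>i<l. mmult (c i) (a i)) y (f x)) \<le> (\<Sum>i<l. opnorm (c i) * (real N * \<eta>))"
        unfolding sum_mat_apply by (rule sum_norm_le) (use prod in auto)
      also have "\<dots> = (\<Sum>i<l. opnorm (c i)) * (real N * \<eta>)"
        by (simp add: sum_distrib_right)
      also have "\<dots> \<le> C * (real N * \<eta>)"
        using \<eta> by (intro mult_right_mono) (auto simp: C_def)
      also have "\<dots> = (1 - \<epsilon>) / 2"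
        using C N(1) by (simp add: \<eta>_def field_simps)
      finally have 1: "cmod ((\<Sum>i<l. mmult (c i) (a i)) y (f x)) \<le> (1 - \<epsilon>) / 2" .
      \<comment> \<open>The band matrix has entry 1 at \<open>(y, f x)\<close>. The approximation
        error and the modulus of the sum's entry then total at most
        \<open>\<epsilon> + (1 - \<epsilon>) / 2\<close>, which is below 1.\<close>
      have "cmod (1 - (\<Sum>i<l. mmult (c i) (a i)) y (f x)) \<le> \<epsilon>"
        using entry_le_opnorm[OF bd, of y "f x"] le y by (simp add: band_mat_def)
      moreover have "1 \<le> cmod (1 - (\<Sum>i<l. mmult (c i) (a i)) y (f x))
          + cmod ((\<Sum>i<l. mmult (c i) (a i)) y (f x))"
        using norm_triangle_ineq[of "1 - (\<Sum>i<l. mmult (c i) (a i)) y (f x)"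
            "(\<Sum>i<l. mmult (c i) (a i)) y (f x)"] by simp
      ultimately show False using 1 ac(2) by argo
    qed
    then have "\<forall>x. cball (f x) r \<subseteq> nbhd (f ` cball x \<delta>) k" by (auto simp: nbhd_def)
    moreover have "\<delta> > 0" using dn by (simp add: \<delta>_def)
    ultimately show ?thesis by blast
  qed
  then show ?thesis unfolding cocoarse_def K_cocoarse_def using k by blast
qed

section \<open>The cycle of implications\<close>

theorem theorem4p6:
  assumes "ulf TYPE('a::metric_space)" and "ulf TYPE('b::metric_space)"
  shows "((\<exists>f::'a \<Rightarrow> 'b. bij f \<and> coarse_quotient f)
          \<longleftrightarrow> (\<exists>\<Phi>::'a mat \<Rightarrow> 'b mat. roe_embedding \<Phi> \<and> \<Phi> ` diag_ops = diag_ops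
                  \<and> cobounded (\<Phi> ` roe)))
       \<and> ((\<exists>\<Phi>::'a mat \<Rightarrow> 'b mat. roe_embedding \<Phi> \<and> \<Phi> ` diag_ops = diag_ops
                  \<and> cobounded (\<Phi> ` roe))
          \<longleftrightarrow> (\<exists>\<epsilon>. 0 < \<epsilon> \<and> \<epsilon> < 1 \<and> (\<exists>\<Phi>::'a mat \<Rightarrow> 'b mat. roe_embedding \<Phi>
                  \<and> \<Phi> ` diag_ops = diag_ops \<and> almost_cobounded \<epsilon> (\<Phi> ` roe) roe)))"
  (is "(?P1 \<longleftrightarrow> ?P2) \<and> (?P2 \<longleftrightarrow> ?P3)")
proof -
  have "?P2" if ?P1
  proof -
    from that obtain f :: "'a \<Rightarrow> 'b" where "bij f" "coarse_map f" "cocoarse f"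
      by (auto simp: coarse_quotient_def)
    then show ?thesis
      using roe_embedding_pull_mat image_diag_ops_pull_mat cobounded_pull_mat[OF assms]
      by (intro exI[of _ "pull_mat (inv f)"]) auto
  qed
  moreover have "?P3" if ?P2
  proof -
    from that obtain \<Phi> :: "'a mat \<Rightarrow> 'b mat"
      where "roe_embedding \<Phi>" "\<Phi> ` diag_ops = diag_ops" "cobounded (\<Phi> ` roe)" by blast
    then show ?thesis
      using cobounded_imp_almost_cobounded[of "\<Phi> ` roe" "1/2"]
      by (intro exI[of _ "1/2"]) auto
  qed
  moreover have "?P1" if ?P3
  proof -
    from that obtain \<epsilon> and \<Phi> :: "'a mat \<Rightarrow> 'b mat" where
      \<epsilon>: "\<epsilon> < 1" and \<Phi>: "roe_embedding \<Phi>" "\<Phi> ` diag_ops = diag_ops"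
      and ac: "almost_cobounded \<epsilon> (\<Phi> ` roe) roe" by blast
    have roe: "\<Phi> ` roe \<subseteq> roe" using \<Phi>(1) by (simp add: roe_embedding_def)
    obtain f where f: "bij f" "\<And>a y x. a \<in> roe \<Longrightarrow> cmod (\<Phi> a (f y) (f x)) = cmod (a y x)"
      using roe_embedding_spatial[OF \<Phi>] by metis
    have "coarse_map f" using coarse_map_if_spatial[OF assms(1) roe f(2)] .
    moreover have "cocoarse f" using cocoarse_if_spatial[OF assms(2) f(1) roe f(2) ac \<epsilon>] .
    ultimately show ?thesis using f(1) by (auto simp: coarse_quotient_def)
  qed
  ultimately show ?thesis by blast
qed

end
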